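(* Let $k\ge 3$ be such that the field $GF(k)$ exists (i.e. $k$ is a prime power). If $G$ is a minimal $k$-cross-theta in which every circle is negative, then $G$ is minimally dependent over $GF(k)$.
   Context: An oriented hypergraph is a quintuple $G=(V,E,I,\iota,\sigma)$ with finite sets of vertices $V$, edges $E$, incidences $I$, an incidence function $\iota:I\to V\times E$ (not necessarily injective), and an orientation $\sigma:I\to\{+1,-1\}$. Its incidence matrix is the $V\times E$ matrix whose $(v,e)$-entry is the sum of $\sigma(i)$ over all $i$ with $\iota(i)=(v,e)$. $G$ is minimally dependent over a field if the columns of the incidence matrix, with entries regarded in that field, are linearly dependent but every proper subset of columns is linearly independent. A path of length $n/2$ is a non-repeating sequence $(a_0,i_1,a_1,\dots,i_n,a_n)$, where the $a_k$ alternate between vertices and edges and $i_k$ is an incidence between $a_{k-1}$ and $a_k$. A circle is a closed path (a cycle of the bipartite multigraph with vertex set $V\cup E$ and edge set $I$). The sign of a circle with $n$ incidences is $(-1)^{\lfloor n/2\rfloor}\prod_{k=1}^n\sigma(i_k)$. A $k$-cross-theta ($k\ge3$) consists of $k$ internally disjoint paths of half-integer length with common end-points (one a vertex, one an edge); it is minimal if it consists of exactly these $k$ paths and nothing else. *)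

theory Defs
  imports Complex_Main "HOL-Library.Function_Algebras" "HOL-Library.Cardinality"
begin

record ('v, 'e, 'i) ohgraph =
  verts :: "'v set"
  edges :: "'e set"
  incs :: "'i set"
  inc_fun :: "'i \<Rightarrow> 'v \<times> 'e"
  orient :: "'i \<Rightarrow> int"

definition oriented_hypergraph :: "('v, 'e, 'i) ohgraph \<Rightarrow> bool" where
  "oriented_hypergraph G \<longleftrightarrow>
     finite (verts G) \<and> finite (edges G) \<and> finite (incs G) \<and>
     inc_fun G ` incs G \<subseteq> verts G \<times> edges G \<and>
     orient G ` incs G \<subseteq> {1, -1}"

definition incidence_matrix :: "('v, 'e, 'i) ohgraph \<Rightarrow> 'v \<Rightarrow> 'e \<Rightarrow> int" where
  "incidence_matrix G v e = (\<Sum>i | i \<in> incs G \<and> inc_fun G i = (v, e). orient G i)"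

text \<open>A column is a vector indexed by the vertices; it is represented as a function on the
  whole type that vanishes outside the vertex set.\<close>

definition column :: "('v, 'e, 'i) ohgraph \<Rightarrow> 'e \<Rightarrow> 'v \<Rightarrow> 'f::field" where
  "column G e = (\<lambda>v. if v \<in> verts G then of_int (incidence_matrix G v e) else 0)"

global_interpretation fun_space: vector_space "\<lambda>(c::'f::field) (x::'v \<Rightarrow> 'f) v. c * x v"
  by unfold_locales (auto simp: fun_eq_iff algebra_simps)

text \<open>Columns form an indexed family: two edges with equal columns count as two columns, which
  are then linearly dependent. The library notion concerns sets of vectors, hence the
  injectivity.\<close>

definition columns_independent :: "'f::field itself \<Rightarrow> ('v, 'e, 'i) ohgraph \<Rightarrow> 'e set \<Rightarrow> bool" where
  "columns_independent _ G S \<longleftrightarrow>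
     inj_on (column G :: 'e \<Rightarrow> 'v \<Rightarrow> 'f) S \<and>
     fun_space.independent ((column G :: 'e \<Rightarrow> 'v \<Rightarrow> 'f) ` S)"

lemma columns_independent_iff:
  assumes "finite S"
  shows "columns_independent TYPE('f::field) G S \<longleftrightarrow>
    (\<forall>c :: _ \<Rightarrow> 'f. (\<forall>v\<in>verts G. (\<Sum>e\<in>S. c e * of_int (incidence_matrix G v e)) = 0) \<longrightarrow>
       (\<forall>e\<in>S. c e = 0))"
proof -
  let ?col = "column G :: _ \<Rightarrow> _ \<Rightarrow> 'f"
  have comb: "(\<Sum>e\<in>S. (\<lambda>v. c e * ?col e v)) = 0 \<longleftrightarrow>
      (\<forall>v\<in>verts G. (\<Sum>e\<in>S. c e * of_int (incidence_matrix G v e)) = 0)" for c :: "_ \<Rightarrow> 'f"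
  proof -
    have "(\<Sum>e\<in>S. (\<lambda>v. c e * ?col e v)) v =
        (if v \<in> verts G then \<Sum>e\<in>S. c e * of_int (incidence_matrix G v e) else 0)" for v
      using assms by (induction S) (auto simp: column_def)
    then show ?thesis
      unfolding fun_eq_iff by (auto split: if_splits)
  qed
  show ?thesis
    unfolding comb [symmetric]
  proof
    assume indep: "columns_independent TYPE('f) G S"
    then have inj: "inj_on ?col S" and ind: "fun_space.independent (?col ` S)"
      by (auto simp: columns_independent_def)
    show "\<forall>c. (\<Sum>e\<in>S. (\<lambda>v. c e * ?col e v)) = 0 \<longrightarrow> (\<forall>e\<in>S. c e = 0)"
    proof (intro allI impI ballI)
      fix c :: "_ \<Rightarrow> 'f" and e
      assume z: "(\<Sum>e\<in>S. (\<lambda>v. c e * ?col e v)) = 0" and e: "e \<in> S"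
      let ?u = "\<lambda>x. c (the_inv_into S ?col x)"
      have "(\<Sum>x\<in>?col ` S. (\<lambda>v. ?u x * x v)) = (\<Sum>e\<in>S. (\<lambda>v. c e * ?col e v))"
        using inj by (subst sum.reindex) (auto simp: the_inv_into_f_f intro!: sum.cong)
      then have "?u (?col e) = 0"
        using ind e assms z fun_space.independentD [of "?col ` S" "?col ` S" ?u "?col e"] by auto
      then show "c e = 0"
        using inj e by (simp add: the_inv_into_f_f)
    qed
  next
    assume *: "\<forall>c. (\<Sum>e\<in>S. (\<lambda>v. c e * ?col e v)) = 0 \<longrightarrow> (\<forall>e\<in>S. c e = 0)"
    have inj: "inj_on ?col S"
    proof (rule inj_onI, rule ccontr)
      fix a b assume ab: "a \<in> S" "b \<in> S" "?col a = ?col b" "a \<noteq> b"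
      let ?c = "\<lambda>e. if e = a then 1 else if e = b then -1 else (0::'f)"
      have "(\<Sum>e\<in>S. (\<lambda>v. ?c e * ?col e v)) = (\<Sum>e\<in>{a, b}. (\<lambda>v. ?c e * ?col e v))"
        using assms ab by (intro sum.mono_neutral_right) (auto simp: fun_eq_iff)
      also have "\<dots> = 0"
        using ab by (auto simp: fun_eq_iff)
      finally show False
        using * ab by fastforce
    qed
    have "fun_space.independent (?col ` S)"
    proof (rule fun_space.independent_if_scalars_zero)
      fix u x
      assume z: "(\<Sum>x\<in>?col ` S. (\<lambda>v. u x * x v)) = 0" and x: "x \<in> ?col ` S"
      have "(\<Sum>e\<in>S. (\<lambda>v. u (?col e) * ?col e v)) = 0"
        using z inj by (subst (asm) sum.reindex) (auto simp: o_def)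
      then show "u x = 0"
        using *[rule_format, of "\<lambda>e. u (?col e)"] x by auto
    qed (use assms in auto)
    then show "columns_independent TYPE('f) G S"
      using inj by (simp add: columns_independent_def)
  qed
qed

definition minimally_dependent :: "'f::field itself \<Rightarrow> ('v, 'e, 'i) ohgraph \<Rightarrow> bool" where
  "minimally_dependent F G \<longleftrightarrow>
     \<not> columns_independent F G (edges G) \<and>
     (\<forall>S. S \<subset> edges G \<longrightarrow> columns_independent F G S)"

definition nodes :: "('v, 'e, 'i) ohgraph \<Rightarrow> ('v + 'e) set" where
  "nodes G = Inl ` verts G \<union> Inr ` edges G"

definition joins :: "('v, 'e, 'i) ohgraph \<Rightarrow> 'i \<Rightarrow> 'v + 'e \<Rightarrow> 'v + 'e \<Rightarrow> bool" where
  "joins G i a b \<longleftrightarrow> i \<in> incs G \<and>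
     (\<exists>v e. inc_fun G i = (v, e) \<and> (a = Inl v \<and> b = Inr e \<or> a = Inr e \<and> b = Inl v))"

text \<open>The sequence \<open>a\<^sub>0, i\<^sub>1, a\<^sub>1, \<dots>, i\<^sub>n, a\<^sub>n\<close> is given by
  \<open>xs = [a\<^sub>0, \<dots>, a\<^sub>n]\<close> and \<open>js = [i\<^sub>1, \<dots>, i\<^sub>n]\<close>. The length of the
  corresponding path is \<open>n / 2\<close>.\<close>

definition walk :: "('v, 'e, 'i) ohgraph \<Rightarrow> ('v + 'e) list \<Rightarrow> 'i list \<Rightarrow> bool" where
  "walk G xs js \<longleftrightarrow> length xs = Suc (length js) \<and> set xs \<subseteq> nodes G \<and>
     (\<forall>m < length js. joins G (js ! m) (xs ! m) (xs ! Suc m))"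

definition path :: "('v, 'e, 'i) ohgraph \<Rightarrow> ('v + 'e) list \<Rightarrow> 'i list \<Rightarrow> bool" where
  "path G xs js \<longleftrightarrow> walk G xs js \<and> distinct xs \<and> distinct js"

text \<open>Two parallel incidences form a circle with two incidences; traversing a single incidence
  back and forth does not, which is excluded by \<open>distinct js\<close>.\<close>

definition circle :: "('v, 'e, 'i) ohgraph \<Rightarrow> ('v + 'e) list \<Rightarrow> 'i list \<Rightarrow> bool" where
  "circle G xs js \<longleftrightarrow> walk G xs js \<and> js \<noteq> [] \<and> hd xs = last xs \<and>
     distinct (butlast xs) \<and> distinct js"

definition circle_sign :: "('v, 'e, 'i) ohgraph \<Rightarrow> 'i list \<Rightarrow> int" where
  "circle_sign G js = (-1) ^ (length js div 2) * prod_list (map (orient G) js)"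

text \<open>A path has half-integer length \<open>n / 2\<close> iff its number \<open>n\<close> of incidences is odd. Disjointness
  of the incidences makes paths of length \<open>1 / 2\<close>, which have no inner nodes, distinct.\<close>

definition cross_theta_paths ::
  "('v, 'e, 'i) ohgraph \<Rightarrow> nat \<Rightarrow> 'v \<Rightarrow> 'e \<Rightarrow> (nat \<Rightarrow> ('v + 'e) list) \<Rightarrow> (nat \<Rightarrow> 'i list) \<Rightarrow> bool"
where
  "cross_theta_paths G k v e xs js \<longleftrightarrow> 3 \<le> k \<and>
     (\<forall>p<k. path G (xs p) (js p) \<and> odd (length (js p)) \<and>
            hd (xs p) = Inl v \<and> last (xs p) = Inr e) \<and>
     (\<forall>p<k. \<forall>q<k. p \<noteq> q \<longrightarrow>
        set (xs p) \<inter> set (xs q) = {Inl v, Inr e} \<and> set (js p) \<inter> set (js q) = {})"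

definition minimal_cross_theta :: "('v, 'e, 'i) ohgraph \<Rightarrow> nat \<Rightarrow> bool" where
  "minimal_cross_theta G k \<longleftrightarrow> (\<exists>v e xs js. cross_theta_paths G k v e xs js \<and>
     nodes G = (\<Union>p<k. set (xs p)) \<and> incs G = (\<Union>p<k. set (js p)))"

end

theory Submission
  imports Defs
begin

text \<open>At an inner vertex of one of the \<open>k\<close> paths exactly two incidences meet, so the corresponding
  row makes the coefficients of a linear relation among the columns propagate along the path up to
  an explicit sign: a relation \<open>c\<close> is determined by its value at the common end-edge \<open>e\<close>, and it is
  nonzero everywhere if it is nonzero at \<open>e\<close>. The row of the common end-vertex \<open>v\<close> then reads
  \<open>(\<Sum>p<k. s p) * c e = 0\<close>, where \<open>s p = \<plusminus>1\<close> and \<open>s p * s q\<close> is minus the sign of the circle formed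
  by the paths \<open>p\<close> and \<open>q\<close>. If all circles are negative then all \<open>s p\<close> agree, and the sum is
  \<open>\<plusminus>k\<close>, which vanishes in a field with \<open>k\<close> elements.\<close>

text \<open>Translation by \<open>1\<close> permutes the ring, so the sum of all elements equals
  itself plus \<open>CARD('f)\<close> copies of \<open>1\<close>. For an infinite type,
  \<open>CARD\<close> is \<open>0\<close> by convention.\<close>

lemma of_nat_CARD_eq_0: "of_nat CARD('f) = (0 :: 'f::ring_1)"
proof (cases "finite (UNIV :: 'f set)")
  case True
  have "(\<Sum>x\<in>(UNIV :: 'f set). x) = (\<Sum>x\<in>UNIV. x + 1)"
    by (rule sum.reindex_bij_witness [of _ "\<lambda>x. x + 1" "\<lambda>x. x - 1"]) auto
  then show ?thesis
    by (simp add: sum.distrib)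
qed simp

section \<open>Walks, and the circle formed by two paths\<close>

lemma joins_sym: "joins G i a b \<longleftrightarrow> joins G i b a"
  by (auto simp: joins_def)

lemma walk_rev:
  assumes "walk G xs js"
  shows "walk G (rev xs) (rev js)"
proof -
  have len: "length xs = Suc (length js)" and nodes: "set xs \<subseteq> nodes G"
    and J: "\<And>m. m < length js \<Longrightarrow> joins G (js ! m) (xs ! m) (xs ! Suc m)"
    using assms by (auto simp: walk_def)
  have "joins G (rev js ! m) (rev xs ! m) (rev xs ! Suc m)" if m: "m < length js" for m
  proof -
    have "Suc (length js - Suc m) = length js - m"
      using m by simp
    then show ?thesis
      using J [of "length js - Suc m"] m len by (simp add: rev_nth joins_sym)
  qed
  then show ?thesis
    using len nodes by (simp add: walk_def)
qed

lemma walk_append: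
  assumes xs: "walk G xs js" and ys: "walk G ys ks" and eq: "last xs = hd ys"
  shows "walk G (xs @ tl ys) (js @ ks)"
proof -
  have len: "length xs = Suc (length js)" "length ys = Suc (length ks)"
    using xs ys by (auto simp: walk_def)
  have ne: "xs \<noteq> []" "ys \<noteq> []"
    using len by auto
  have left: "(xs @ tl ys) ! l = xs ! l" if "l \<le> length js" for l
    using that len by (simp add: nth_append)
  \<comment> \<open>At \<open>l = 0\<close> both sides are the glued node, which is the last of
    \<open>xs\<close> and the dropped head of \<open>ys\<close>.\<close>
  have right: "(xs @ tl ys) ! (length js + l) = ys ! l" if "l \<le> length ks" for l
  proof (cases l)
    case 0
    then show ?thesis
      using ne len eq by (simp add: nth_append last_conv_nth hd_conv_nth)
  next
    case (Suc l')
    then show ?thesis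
      using that len by (simp add: nth_append nth_tl)
  qed
  have "joins G ((js @ ks) ! m) ((xs @ tl ys) ! m) ((xs @ tl ys) ! Suc m)"
    if m: "m < length (js @ ks)" for m
  proof (cases "m < length js")
    case True
    then show ?thesis
      using xs left [of m] left [of "Suc m"] by (simp add: nth_append walk_def)
  next
    case False
    define l where "l = m - length js"
    have l: "m = length js + l" "l < length ks"
      using False m by (auto simp: l_def)
    then show ?thesis
      using ys right [of l] right [of "Suc l"] by (simp add: walk_def)
  qed
  moreover have "set (xs @ tl ys) \<subseteq> nodes G"
    using xs ys ne by (auto simp: walk_def dest: list.set_sel(2))
  ultimately show ?thesis
    using len by (simp add: walk_def)
qed

text \<open>Traverse the first path from \<open>a\<close> to \<open>b\<close> and return along the
  reverse of the second. Only the ends are shared, so the sole repetition is \<open>a\<close>, which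
  closes the circle. Two parallel incidences are included as the shortest case.\<close>

lemma circle_of_paths:
  assumes P: "path G xs js" "path G ys ks"
    and ends: "hd xs = a" "hd ys = a" "last xs = b" "last ys = b" "a \<noteq> b"
    and disj: "set xs \<inter> set ys = {a, b}" "set js \<inter> set ks = {}"
  shows "circle G (xs @ tl (rev ys)) (js @ rev ks)"
proof -
  have W: "walk G xs js" "walk G ys ks" and D: "distinct xs" "distinct ys" "distinct js" "distinct ks"
    using P by (auto simp: path_def)
  have ne: "xs \<noteq> []" "ys \<noteq> []"
    using W by (auto simp: walk_def)
  \<comment> \<open>With this shape \<open>tl (rev ys)\<close> is \<open>rev zs @ [a]\<close>, so
    \<open>butlast\<close> leaves \<open>xs @ rev zs\<close>.\<close>
  obtain zs where zs: "ys = a # zs @ [b]"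
  proof -
    obtain ys' where "ys = a # ys'"
      using ne ends by (cases ys) auto
    moreover from this have "ys' \<noteq> []" "last ys' = b"
      using ends by (auto split: if_splits)
    then have "ys' = butlast ys' @ [b]"
      using append_butlast_last_id by metis
    ultimately show thesis
      using that by metis
  qed
  have walk: "walk G (xs @ tl (rev ys)) (js @ rev ks)"
    using W ne ends by (intro walk_append walk_rev) (auto simp: hd_rev)
  have "set xs \<inter> set zs = {}"
    using disj(1) D(2) zs by auto
  then have "distinct (butlast (xs @ tl (rev ys)))"
    using zs D by (simp add: butlast_append)
  moreover have "js \<noteq> []"
    using W ends ne by (auto simp: walk_def length_Suc_conv)
  moreover have "hd (xs @ tl (rev ys)) = last (xs @ tl (rev ys))"
    using ends ne zs by simp
  ultimately show ?thesis
    using walk D disj(2) by (simp add: circle_def)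
qed

text \<open>Grouping the incidences at \<open>w\<close> by their edge turns a row of the matrix into
  a sum over incidences, in which parallel incidences keep separate terms.\<close>

lemma row_sum:
  fixes c :: "'e \<Rightarrow> 'f::field" and G :: "('v, 'e, 'i) ohgraph"
  assumes "oriented_hypergraph G"
  shows "(\<Sum>x\<in>edges G. c x * of_int (incidence_matrix G w x)) =
    (\<Sum>i | i \<in> incs G \<and> fst (inc_fun G i) = w. c (snd (inc_fun G i)) * of_int (orient G i))"
    (is "_ = sum ?h ?I")
proof -
  have fin: "finite ?I" "finite (edges G)" and im: "(\<lambda>i. snd (inc_fun G i)) ` ?I \<subseteq> edges G"
    using assms by (auto simp: oriented_hypergraph_def dest!: image_subset_iff [THEN iffD1])
  have "c x * of_int (incidence_matrix G w x) = sum ?h {i \<in> ?I. snd (inc_fun G i) = x}" for x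
  proof -
    have "{i \<in> ?I. snd (inc_fun G i) = x} = {i \<in> incs G. inc_fun G i = (w, x)}"
      by (auto simp: prod_eq_iff)
    then show ?thesis
      by (simp add: incidence_matrix_def sum_distrib_left)
  qed
  then show ?thesis
    using sum.group [OF fin im, of ?h] by simp
qed

section \<open>Positions of nodes and incidences on the paths of a cross-theta\<close>

locale cross_theta =
  fixes G :: "('v, 'e, 'i) ohgraph" and k :: nat and v :: 'v and e :: 'e
    and xs :: "nat \<Rightarrow> ('v + 'e) list" and js :: "nat \<Rightarrow> 'i list"
  assumes hypergraph: "oriented_hypergraph G"
    and paths: "cross_theta_paths G k v e xs js"
    and nodes_eq: "nodes G = (\<Union>p<k. set (xs p))"
    and incs_eq: "incs G = (\<Union>p<k. set (js p))"
begin

abbreviation n :: "nat \<Rightarrow> nat" where "n p \<equiv> length (js p)"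

lemma k_pos: "0 < k"
  using paths by (simp add: cross_theta_paths_def)

lemma
  assumes "p < k"
  shows path: "path G (xs p) (js p)" and odd_n: "odd (n p)"
    and hd_xs: "hd (xs p) = Inl v" and last_xs: "last (xs p) = Inr e"
  using paths assms by (auto simp: cross_theta_paths_def)

lemma
  assumes "p < k"
  shows length_xs: "length (xs p) = Suc (n p)"
    and distinct_xs: "distinct (xs p)" and distinct_js: "distinct (js p)"
    and joins: "m < n p \<Longrightarrow> joins G (js p ! m) (xs p ! m) (xs p ! Suc m)"
  using path [OF assms] by (auto simp: path_def walk_def)

lemma n_pos: "p < k \<Longrightarrow> 0 < n p"
  using odd_n by (metis even_zero gr0I)

lemma xs_0: "p < k \<Longrightarrow> xs p ! 0 = Inl v"
  using hd_xs length_xs by (metis hd_conv_nth length_0_conv nat.distinct(1))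

lemma xs_n: "p < k \<Longrightarrow> xs p ! n p = Inr e"
  using last_xs length_xs by (metis diff_Suc_1 last_conv_nth length_0_conv nat.distinct(1))

lemma
  assumes "p < k" "q < k" "p \<noteq> q"
  shows xs_Int: "set (xs p) \<inter> set (xs q) = {Inl v, Inr e}"
    and js_Int: "set (js p) \<inter> set (js q) = {}"
  using paths assms by (auto simp: cross_theta_paths_def)

text \<open>Two different paths meet only in \<open>v\<close> and \<open>e\<close>, and a single
  path repeats no node; so only the common ends have more than one position.\<close>

lemma node_cases:
  assumes p: "p < k" "m \<le> n p" and q: "q < k" "l \<le> n q" and eq: "xs p ! m = xs q ! l"
  shows "p = q \<and> m = l \<or> m = 0 \<and> l = 0 \<or> m = n p \<and> l = n q"
proof -
  have idx: "(xs r ! a = xs r ! b) = (a = b)" if "r < k" "a \<le> n r" "b \<le> n r" for r a b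
    using that by (intro nth_eq_iff_index_eq) (auto simp: distinct_xs length_xs)
  show ?thesis
  proof (cases "p = q")
    case True
    then show ?thesis
      using idx assms by simp
  next
    case False
    have "xs p ! m \<in> set (xs p) \<inter> set (xs q)"
      using assms by (metis IntI length_xs less_Suc_eq_le nth_mem)
    then have "xs p ! m = Inl v \<or> xs p ! m = Inr e"
      using xs_Int [OF p(1) q(1) False] by auto
    then show ?thesis
      using idx p q eq xs_0 xs_n by (metis le_refl zero_le)
  qed
qed

lemma isl_xs:
  assumes "p < k"
  shows "m \<le> n p \<Longrightarrow> isl (xs p ! m) \<longleftrightarrow> even m"
proof (induction m)
  case 0
  then show ?case using xs_0 assms by simp
next
  case (Suc m)
  then show ?case using joins [OF assms, of m] by (auto simp: joins_def)
qed

lemma inc_even: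
  assumes "p < k" "m < n p" "even m"
  shows "xs p ! m = Inl (fst (inc_fun G (js p ! m)))"
    and "xs p ! Suc m = Inr (snd (inc_fun G (js p ! m)))"
  using joins [OF assms(1,2)] isl_xs [of p m] assms by (auto simp: joins_def)

lemma inc_odd:
  assumes "p < k" "m < n p" "odd m"
  shows "xs p ! m = Inr (snd (inc_fun G (js p ! m)))"
    and "xs p ! Suc m = Inl (fst (inc_fun G (js p ! m)))"
  using joins [OF assms(1,2)] isl_xs [of p m] assms by (auto simp: joins_def)

lemma incs_cases:
  assumes "i \<in> incs G"
  obtains p m where "p < k" "m < n p" "i = js p ! m"
  using assms by (auto simp: incs_eq in_set_conv_nth)

lemma js_in_incs: "p < k \<Longrightarrow> m < n p \<Longrightarrow> js p ! m \<in> incs G"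
  unfolding incs_eq by (blast intro: nth_mem)

lemma edge_cases:
  assumes "x \<in> edges G"
  obtains p m where "p < k" "m \<le> n p" "odd m" "xs p ! m = Inr x"
proof -
  have "Inr x \<in> nodes G"
    using assms by (auto simp: nodes_def)
  then obtain p m where "p < k" "m \<le> n p" "xs p ! m = Inr x"
    by (auto simp: nodes_eq in_set_conv_nth length_xs less_Suc_eq_le)
  then show thesis
    using that isl_xs [of p m] by auto
qed

text \<open>Each path starts at \<open>v\<close> and ends at an edge, so any other vertex is an
  inner node. Writing its position as \<open>Suc m\<close> puts the two neighbouring edges at
  \<open>m\<close> and \<open>Suc (Suc m)\<close>.\<close>

lemma vertex_cases:
  assumes "w \<in> verts G"
  obtains "w = v" | p m where "p < k" "Suc m < n p" "odd m" "xs p ! Suc m = Inl w"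
proof -
  have "Inl w \<in> nodes G"
    using assms by (auto simp: nodes_def)
  then obtain p m where pm: "p < k" "m \<le> n p" "xs p ! m = Inl w"
    by (auto simp: nodes_eq in_set_conv_nth length_xs less_Suc_eq_le)
  have "even m"
    using isl_xs [of p m] pm by simp
  then show thesis
    using that pm xs_0 [of p] xs_n [of p] by (cases m) (auto simp: le_less)
qed

lemma node_in_nodes: "p < k \<Longrightarrow> m \<le> n p \<Longrightarrow> xs p ! m \<in> nodes G"
  unfolding nodes_eq using length_xs by (auto simp: less_Suc_eq_le intro!: bexI [of _ p] nth_mem)

lemma e_in_edges: "e \<in> edges G"
  using node_in_nodes [of 0 "n 0"] k_pos xs_n [of 0] by (auto simp: nodes_def)

text \<open>Meaningful at odd positions only, where the node is an edge; \<open>projr\<close> is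
  unspecified at a vertex.\<close>

definition edge :: "nat \<Rightarrow> nat \<Rightarrow> 'e" where
  "edge p m = projr (xs p ! m)"

lemma Inr_edge: "p < k \<Longrightarrow> m \<le> n p \<Longrightarrow> odd m \<Longrightarrow> xs p ! m = Inr (edge p m)"
  using isl_xs [of p m] by (cases "xs p ! m") (auto simp: edge_def)

lemma edge_n: "p < k \<Longrightarrow> edge p (n p) = e"
  by (simp add: edge_def xs_n)

abbreviation \<sigma> :: "nat \<Rightarrow> nat \<Rightarrow> int" where "\<sigma> p m \<equiv> orient G (js p ! m)"

lemma \<sigma>_square: "p < k \<Longrightarrow> m < n p \<Longrightarrow> \<sigma> p m * \<sigma> p m = 1"
  using hypergraph js_in_incs [of p m] by (auto simp: oriented_hypergraph_def)

section \<open>Incidences at a vertex, and the rows of the matrix\<close>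

lemma vertex_of_inc:
  assumes "p < k" "m < n p"
  shows "xs p ! (if even m then m else Suc m) = Inl (fst (inc_fun G (js p ! m)))"
  using inc_even(1) [of p m] inc_odd(2) [of p m] assms by auto

text \<open>The vertex end of an incidence lies at the even one of its two positions. As
  \<open>Suc m\<close> is neither \<open>0\<close> nor \<open>n p\<close>, \<open>node_cases\<close>
  forces this position to be \<open>Suc m\<close> on path \<open>p\<close>, which leaves the
  incidences just before and just after it.\<close>

lemma incs_at_inner_vertex:
  assumes p: "p < k" "Suc m < n p" "odd m" "xs p ! Suc m = Inl w"
  shows "{i \<in> incs G. fst (inc_fun G i) = w} = {js p ! m, js p ! Suc m}"
proof (intro equalityI subsetI)
  fix i assume i: "i \<in> {i \<in> incs G. fst (inc_fun G i) = w}"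
  then obtain q l where q: "q < k" "l < n q" "i = js q ! l"
    by (auto elim: incs_cases)
  let ?l = "if even l then l else Suc l"
  have "xs q ! ?l = xs p ! Suc m"
    using vertex_of_inc [of q l] q i p by simp
  then have "q = p \<and> ?l = Suc m"
    using node_cases [of q ?l p "Suc m"] p q by auto
  then show "i \<in> {js p ! m, js p ! Suc m}"
    using q by (auto split: if_splits)
next
  fix i assume "i \<in> {js p ! m, js p ! Suc m}"
  then show "i \<in> {i \<in> incs G. fst (inc_fun G i) = w}"
    using p inc_odd(2) [of p m] inc_even(1) [of p "Suc m"] js_in_incs by auto
qed

lemma incs_at_v: "{i \<in> incs G. fst (inc_fun G i) = v} = (\<lambda>p. js p ! 0) ` {..<k}"
proof (intro equalityI subsetI)
  fix i assume i: "i \<in> {i \<in> incs G. fst (inc_fun G i) = v}"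
  then obtain q l where q: "q < k" "l < n q" "i = js q ! l"
    by (auto elim: incs_cases)
  define l' where "l' = (if even l then l else Suc l)"
  have "l' \<le> n q" "xs q ! l' = xs q ! 0"
    using vertex_of_inc [of q l] q i xs_0 [of q] by (auto simp: l'_def)
  then have "l' = 0"
    using node_cases [of q l' q 0] q by auto
  then have "l = 0"
    by (simp add: l'_def split: if_splits)
  then show "i \<in> (\<lambda>p. js p ! 0) ` {..<k}"
    using q by auto
next
  fix i assume "i \<in> (\<lambda>p. js p ! 0) ` {..<k}"
  then show "i \<in> {i \<in> incs G. fst (inc_fun G i) = v}"
    using inc_even(1) [of _ 0] n_pos xs_0 js_in_incs by fastforce
qed

lemma row_inner_vertex:
  fixes c :: "'e \<Rightarrow> 'f::field"
  assumes p: "p < k" "Suc m < n p" "odd m" "xs p ! Suc m = Inl w"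
  shows "(\<Sum>x\<in>edges G. c x * of_int (incidence_matrix G w x)) =
    c (edge p m) * of_int (\<sigma> p m) + c (edge p (Suc (Suc m))) * of_int (\<sigma> p (Suc m))"
proof -
  have "js p ! m \<noteq> js p ! Suc m"
    using p distinct_js [of p] by (simp add: nth_eq_iff_index_eq)
  then show ?thesis
    using inc_odd(1) [of p m] inc_even(2) [of p "Suc m"] p
    by (simp add: row_sum [OF hypergraph] incs_at_inner_vertex [OF p] edge_def)
qed

lemma row_v:
  fixes c :: "'e \<Rightarrow> 'f::field"
  shows "(\<Sum>x\<in>edges G. c x * of_int (incidence_matrix G v x)) =
    (\<Sum>p<k. c (edge p 1) * of_int (\<sigma> p 0))"
proof -
  \<comment> \<open>Different paths share no incidence, so each contributes its own term, even when
    several consist of a single incidence between \<open>v\<close> and \<open>e\<close>.\<close>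
  have "inj_on (\<lambda>p. js p ! 0) {..<k}"
  proof (intro inj_onI, rule ccontr)
    fix p q assume "p \<in> {..<k}" "q \<in> {..<k}" "js p ! 0 = js q ! 0" "p \<noteq> q"
    then show False
      using js_Int [of p q] n_pos [of p] n_pos [of q] by (metis IntI emptyE lessThan_iff nth_mem)
  qed
  then show ?thesis
    using inc_even(2) [of _ 0] n_pos
    by (auto simp: row_sum [OF hypergraph] incs_at_v sum.reindex edge_def intro!: sum.cong)
qed

section \<open>Propagation of a relation along a path\<close>

text \<open>For odd \<open>m\<close> this is the factor expressing \<open>c (edge p m)\<close>
  through \<open>c e\<close> for a relation \<open>c\<close>. Between the positions \<open>m\<close>
  and \<open>n p\<close> lie \<open>(n p - m) div 2\<close> vertices, and the row of each
  contributes a minus sign and its two incidence signs.\<close>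

definition t :: "nat \<Rightarrow> nat \<Rightarrow> int" where
  "t p m = (-1) ^ ((n p - m) div 2) * (\<Prod>l=m..<n p. \<sigma> p l)"

lemma t_n: "t p (n p) = 1"
  by (simp add: t_def)

lemma t_step:
  assumes "Suc m < n p"
  shows "t p m = - \<sigma> p m * \<sigma> p (Suc m) * t p (Suc (Suc m))"
proof -
  have "n p - m = Suc (Suc (n p - Suc (Suc m)))"
    using assms by simp
  then have "(n p - m) div 2 = Suc ((n p - Suc (Suc m)) div 2)"
    by simp
  then show ?thesis
    using assms by (simp add: t_def prod.atLeast_Suc_lessThan)
qed

text \<open>The left side is the sign \<open>s p\<close> with which path \<open>p\<close> enters the
  row of \<open>v\<close>; the right side is the share of the path in the sign of a circle. The
  exponents agree because \<open>n p\<close> is odd.\<close>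

lemma \<sigma>_t_1:
  assumes "p < k"
  shows "\<sigma> p 0 * t p 1 = (-1) ^ (n p div 2) * prod_list (map (orient G) (js p))"
proof -
  have "prod_list (map (orient G) (js p)) = (\<Prod>l=0..<n p. \<sigma> p l)"
    by (simp add: prod.list_conv_set_nth)
  moreover have "(n p - 1) div 2 = n p div 2"
    using odd_n [OF assms] by (auto elim: oddE)
  ultimately show ?thesis
    using n_pos [OF assms] by (simp add: t_def prod.atLeast_Suc_lessThan)
qed

lemma t_square:
  assumes "p < k"
  shows "t p m * t p m = 1"
proof -
  have "(\<Prod>l=m..<n p. \<sigma> p l) * (\<Prod>l=m..<n p. \<sigma> p l) = (\<Prod>l=m..<n p. \<sigma> p l * \<sigma> p l)"
    by (simp add: prod.distrib)
  also have "\<dots> = 1"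
    using \<sigma>_square [OF assms] by (intro prod.neutral) simp
  finally show ?thesis
    by (simp add: t_def algebra_simps flip: power_add mult.assoc)
qed

text \<open>The induction runs backwards from \<open>e\<close>: the row of the vertex at
  \<open>Suc m\<close> carries the claim from position \<open>Suc (Suc m)\<close> to
  \<open>m\<close>.\<close>

lemma relation_along_path:
  fixes c :: "'e \<Rightarrow> 'f::field"
  assumes rel: "\<forall>w\<in>verts G. (\<Sum>x\<in>edges G. c x * of_int (incidence_matrix G w x)) = 0"
    and p: "p < k" and m: "m \<le> n p" "odd m"
  shows "c (edge p m) = of_int (t p m) * c e"
  using m
proof (induction "n p - m" arbitrary: m rule: less_induct)
  case less
  show ?case
  proof (cases "m = n p")
    case True
    then show ?thesis
      by (simp add: edge_n p t_n)
  next
    case False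
    \<comment> \<open>Both \<open>m\<close> and \<open>n p\<close> are odd, so \<open>Suc m\<close>
      cannot equal \<open>n p\<close>.\<close>
    then have m: "Suc m < n p"
      using less.prems odd_n [OF p] by (metis Suc_lessI even_Suc le_neq_implies_less)
    obtain w where w: "xs p ! Suc m = Inl w"
      using inc_odd(2) [of p m] less.prems m p by auto
    then have "w \<in> verts G"
      using node_in_nodes [of p "Suc m"] m p by (auto simp: nodes_def)
    then have "c (edge p m) * of_int (\<sigma> p m) +
        c (edge p (Suc (Suc m))) * of_int (\<sigma> p (Suc m)) = 0"
      using rel row_inner_vertex [OF p m less.prems(2) w, of c] by simp
    then have eq: "c (edge p m) * of_int (\<sigma> p m) =
        - (c (edge p (Suc (Suc m))) * of_int (\<sigma> p (Suc m)))"
      by (simp only: add_eq_0_iff2)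
    \<comment> \<open>In the field \<open>\<sigma> p m\<close> is its own inverse, so the row
      equation can be solved for \<open>c (edge p m)\<close>.\<close>
    have "of_int (\<sigma> p m) * of_int (\<sigma> p m) = (1 :: 'f)"
      using \<sigma>_square [of p m] p m by (simp flip: of_int_mult)
    then have "c (edge p m) = c (edge p m) * of_int (\<sigma> p m) * of_int (\<sigma> p m)"
      by (simp only: mult.assoc mult_1_right)
    also have "\<dots> = - (c (edge p (Suc (Suc m))) * of_int (\<sigma> p (Suc m))) * of_int (\<sigma> p m)"
      by (simp only: eq)
    also have "c (edge p (Suc (Suc m))) = of_int (t p (Suc (Suc m))) * c e"
      using less m by simp
    finally show ?thesis
      by (simp add: t_step [OF m] ac_simps)
  qed
qed

text \<open>The factors \<open>t p m\<close> square to \<open>1\<close> and are therefore units in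
  every field. A zero at one edge thus forces \<open>c e = 0\<close>, and this spreads to all
  edges.\<close>

lemma relation_eq_0:
  fixes c :: "'e \<Rightarrow> 'f::field"
  assumes rel: "\<forall>w\<in>verts G. (\<Sum>x\<in>edges G. c x * of_int (incidence_matrix G w x)) = 0"
    and x: "x \<in> edges G" "c x = 0" and y: "y \<in> edges G"
  shows "c y = 0"
proof -
  have on_edge: "\<exists>p m. p < k \<and> c z = of_int (t p m) * c e" if z: "z \<in> edges G" for z
  proof -
    obtain p m where "p < k" "m \<le> n p" "odd m" "xs p ! m = Inr z"
      using z by (rule edge_cases)
    then show ?thesis
      using relation_along_path [OF rel, of p m] by (auto simp: edge_def)
  qed
  obtain p m where p: "p < k" "of_int (t p m) * c e = 0"
    using on_edge [OF x(1)] x(2) by auto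
  have "of_int (t p m) * of_int (t p m) = (1 :: 'f)"
    using t_square [OF p(1), of m] by (simp flip: of_int_mult)
  then have "c e = 0"
    using p(2) by auto
  then show ?thesis
    using on_edge [OF y] by auto
qed

section \<open>Independence of proper subsets of the columns\<close>

lemma proper_columns_independent:
  assumes S: "S \<subset> edges G"
  shows "columns_independent TYPE('f::field) G S"
proof -
  have fin: "finite (edges G)"
    using hypergraph by (simp add: oriented_hypergraph_def)
  have "c y = 0"
    if rel: "\<forall>w\<in>verts G. (\<Sum>x\<in>S. c x * of_int (incidence_matrix G w x)) = 0" and y: "y \<in> S"
    for c :: "'e \<Rightarrow> 'f" and y
  proof -
    \<comment> \<open>A relation on \<open>S\<close> extended by zero is a relation on all edges
      that vanishes at an edge outside \<open>S\<close>, hence everywhere.\<close>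
    let ?c = "\<lambda>x. if x \<in> S then c x else 0"
    have "(\<Sum>x\<in>edges G. ?c x * of_int (incidence_matrix G w x)) =
        (\<Sum>x\<in>S. c x * of_int (incidence_matrix G w x))" for w
      using fin S by (intro sum.mono_neutral_cong_right) auto
    then have "\<forall>w\<in>verts G. (\<Sum>x\<in>edges G. ?c x * of_int (incidence_matrix G w x)) = 0"
      using rel by simp
    moreover obtain x where "x \<in> edges G" "x \<notin> S"
      using S by auto
    ultimately show "c y = 0"
      using relation_eq_0 [of ?c x y] S y by auto
  qed
  then show ?thesis
    using columns_independent_iff [of S G, where 'f = 'f] fin S finite_subset by blast
qed

section \<open>The relation among all columns when every circle is negative\<close>

text \<open>The choice is harmless: an edge other than \<open>e\<close> has only one position, and \<open>t p m = 1\<close> at all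
  positions of \<open>e\<close>.\<close>

definition coeff :: "'e \<Rightarrow> int" where
  "coeff x = (SOME y. \<exists>p m. p < k \<and> m \<le> n p \<and> xs p ! m = Inr x \<and> y = t p m)"

lemma coeff_edge:
  assumes p: "p < k" "m \<le> n p" "odd m"
  shows "coeff (edge p m) = t p m"
  unfolding coeff_def
proof (rule some_equality)
  show "\<exists>q l. q < k \<and> l \<le> n q \<and> xs q ! l = Inr (edge p m) \<and> t p m = t q l"
    using p Inr_edge by blast
next
  fix y assume "\<exists>q l. q < k \<and> l \<le> n q \<and> xs q ! l = Inr (edge p m) \<and> y = t q l"
  then obtain q l where "q < k" "l \<le> n q" "xs q ! l = xs p ! m" "y = t q l"
    using p Inr_edge by metis
  then show "y = t p m"
    using node_cases [of q l p m] p by (auto simp: t_n)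
qed

lemma sign_constant:
  assumes neg: "\<And>xs js. circle G xs js \<Longrightarrow> circle_sign G js = -1"
    and pq: "p < k" "q < k"
  shows "\<sigma> p 0 * t p 1 = \<sigma> q 0 * t q 1"
proof (cases "p = q")
  case False
  let ?a = "\<lambda>r. \<sigma> r 0 * t r 1"
  have "circle G (xs p @ tl (rev (xs q))) (js p @ rev (js q))"
    using pq by (intro circle_of_paths [OF _ _ _ _ _ _ _ xs_Int js_Int])
      (auto simp: path hd_xs last_xs False)
  then have "circle_sign G (js p @ rev (js q)) = -1"
    by (rule neg)
  \<comment> \<open>Halving two odd lengths separately loses one unit in total. The resulting extra
    factor \<open>-1\<close> turns the negative circle sign into the product \<open>1\<close> of the
    two path signs.\<close>
  moreover have "(n p + n q) div 2 = Suc (n p div 2 + n q div 2)"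
    using odd_n [OF pq(1)] odd_n [OF pq(2)] by (auto elim!: oddE)
  moreover have "prod_list (rev zs) = prod_list zs" for zs :: "int list"
    by (induction zs) auto
  ultimately have "?a p * ?a q = 1"
    unfolding \<sigma>_t_1 [OF pq(1)] \<sigma>_t_1 [OF pq(2)]
    by (simp add: circle_sign_def power_add ac_simps flip: rev_map)
  moreover have "?a q * ?a q = (\<sigma> q 0 * \<sigma> q 0) * (t q 1 * t q 1)"
    by (simp only: ac_simps)
  then have "?a q * ?a q = 1"
    by (simp only: \<sigma>_square [OF pq(2) n_pos [OF pq(2)]] t_square [OF pq(2)] mult_1)
  ultimately have "?a p * ?a q = ?a q * ?a q" "?a q \<noteq> 0"
    by auto
  then show ?thesis
    by simp
qed simp

lemma columns_dependent:
  assumes neg: "\<And>xs js. circle G xs js \<Longrightarrow> circle_sign G js = -1"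
    and k: "of_nat k = (0 :: 'f::field)"
  shows "\<not> columns_independent TYPE('f) G (edges G)"
proof -
  \<comment> \<open>The witness is the relation obtained by propagating the value \<open>1\<close>
    from \<open>e\<close> along all paths.\<close>
  let ?c = "\<lambda>x. of_int (coeff x) :: 'f"
  have rel: "(\<Sum>x\<in>edges G. ?c x * of_int (incidence_matrix G w x)) = 0" if "w \<in> verts G" for w
    using that
  proof (cases rule: vertex_cases)
    case 1
    \<comment> \<open>Every path contributes the same sign as path \<open>0\<close>, so the row of
      \<open>v\<close> sums to \<open>k\<close> times that sign, which is zero in the field.\<close>
    have "(\<Sum>p<k. ?c (edge p 1) * of_int (\<sigma> p 0)) = (\<Sum>p<k. of_int (\<sigma> 0 0 * t 0 1))"
    proof (intro sum.cong refl)
      fix p assume p: "p \<in> {..<k}"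
      then have "coeff (edge p 1) = t p 1"
        using n_pos [of p] by (intro coeff_edge) (simp_all add: Suc_le_eq)
      moreover have "\<sigma> p 0 * t p 1 = \<sigma> 0 0 * t 0 1"
        using p k_pos by (intro sign_constant neg) auto
      ultimately have "coeff (edge p 1) * \<sigma> p 0 = \<sigma> 0 0 * t 0 1"
        by (simp only: mult.commute)
      then show "?c (edge p 1) * of_int (\<sigma> p 0) = of_int (\<sigma> 0 0 * t 0 1)"
        by (metis of_int_mult)
    qed
    then show ?thesis
      using k 1 by (simp add: row_v)
  next
    case (2 p m)
    \<comment> \<open>The row of an inner vertex already vanishes over the integers, so the
      computation is done there and then mapped to the field.\<close>
    have "coeff (edge p m) * \<sigma> p m + coeff (edge p (Suc (Suc m))) * \<sigma> p (Suc m) =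
        t p m * \<sigma> p m + t p (Suc (Suc m)) * \<sigma> p (Suc m)"
      using 2 by (simp add: coeff_edge)
    also have "\<dots> = t p (Suc (Suc m)) * \<sigma> p (Suc m) * (1 - \<sigma> p m * \<sigma> p m)"
      using 2 by (simp add: t_step algebra_simps)
    also have "\<dots> = 0"
      using 2 by (simp add: \<sigma>_square)
    finally show ?thesis
      unfolding row_inner_vertex [OF 2] by (metis of_int_0 of_int_add of_int_mult)
  qed
  have "coeff e = 1"
    using coeff_edge [of 0 "n 0"] k_pos by (simp add: odd_n edge_n t_n)
  then have c_e: "?c e \<noteq> 0"
    by simp
  have fin: "finite (edges G)"
    using hypergraph by (simp add: oriented_hypergraph_def)
  show ?thesis
  proof
    assume "columns_independent TYPE('f) G (edges G)"
    then have "\<forall>x\<in>edges G. ?c x = 0"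
      unfolding columns_independent_iff [OF fin] using rel by (auto dest: spec [of _ ?c])
    then show False
      using c_e e_in_edges by blast
  qed
qed

end

theorem corollary4p1p3:
  fixes G :: "('v, 'e, 'i) ohgraph" and k :: nat
  assumes "k \<ge> 3"
    and "CARD('f::field) = k"
    and "oriented_hypergraph G"
    and "minimal_cross_theta G k"
    and "\<And>xs js. circle G xs js \<Longrightarrow> circle_sign G js = -1"
  shows "minimally_dependent TYPE('f) G"
proof -
  obtain v e xs js where "cross_theta_paths G k v e xs js"
    "nodes G = (\<Union>p<k. set (xs p))" "incs G = (\<Union>p<k. set (js p))"
    using assms(4) by (auto simp: minimal_cross_theta_def)
  then interpret cross_theta G k v e xs js
    using assms(3) by unfold_locales
  have "of_nat k = (0 :: 'f)"
    using of_nat_CARD_eq_0 [where 'f = 'f] assms(2) by simp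
  then show ?thesis
    using columns_dependent [OF assms(5)] proper_columns_independent
    by (auto simp: minimally_dependent_def)
qed

end
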